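(* Let $H$ be a noncomplete graph of order $n'$ and let $n\ge 2$ be an integer. Then the following assertions hold. (i) If $\gamma_{\rm sp}(H)=n'-1$, then $\gamma_{\rm sp}(K_n\circ H)=nn'-2$. (ii) If $\gamma_{\rm sp}(H)\le n'-2$, then $\gamma_{\rm sp}(K_n\circ H)=n'(n-1)+\gamma_{\rm sp}(H)$.
   Context: All graphs are finite, simple and undirected, with nonempty vertex set; the order of a graph is its number of vertices. $K_n$ is the complete graph of order $n$. For a vertex $v$ of $G$, $N(v)$ is the set of vertices adjacent to $v$, and for $D\subseteq V(G)$, $\overline{D}=V(G)\setminus D$. A set $D\subseteq V(G)$ is a super dominating set of $G$ if for every $u\in\overline{D}$ there exists $v\in D$ such that $N(v)\cap\overline{D}=\{u\}$. The super domination number $\gamma_{\rm sp}(G)$ is the minimum cardinality of a super dominating set of $G$. The lexicographic product $G\circ H$ has vertex set $V(G)\times V(H)$, and $(g,h)$ is adjacent to $(g',h')$ if and only if $gg'\in E(G)$, or $g=g'$ and $hh'\in E(H)$. *)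

theory Defs
  imports "Graph_Theory.Graph_Theory"
begin

(* A finite simple undirected graph is a pair_graph: a finite, loop-free, symmetric digraph
   whose arcs are pairs of vertices, so that each edge {u,v} occurs as both (u,v) and (v,u). *)

definition neighbourhood :: "'a pair_pre_digraph \<Rightarrow> 'a \<Rightarrow> 'a set" where
  "neighbourhood G v = {u \<in> pverts G. (v, u) \<in> parcs G}"

definition super_dominating_set :: "'a pair_pre_digraph \<Rightarrow> 'a set \<Rightarrow> bool" where
  "super_dominating_set G D \<longleftrightarrow>
     D \<subseteq> pverts G \<and>
     (\<forall>u \<in> pverts G - D. \<exists>v \<in> D. neighbourhood G v \<inter> (pverts G - D) = {u})"

(* For a finite graph the set below is finite, and it is nonempty by
   super_dominating_set_pverts, so that the minimum is attained. *)
definition super_domination_number :: "'a pair_pre_digraph \<Rightarrow> nat" where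
  "super_domination_number G = Min (card ` {D. super_dominating_set G D})"

definition lexicographic_product ::
    "'a pair_pre_digraph \<Rightarrow> 'b pair_pre_digraph \<Rightarrow> ('a \<times> 'b) pair_pre_digraph" where
  "lexicographic_product G H =
     \<lparr> pverts = pverts G \<times> pverts H,
       parcs = {((g, h), (g', h')).
                  (g, h) \<in> pverts G \<times> pverts H \<and> (g', h') \<in> pverts G \<times> pverts H \<and>
                  ((g, g') \<in> parcs G \<or> g = g' \<and> (h, h') \<in> parcs H)} \<rparr>"

lemma super_dominating_set_pverts: "super_dominating_set G (pverts G)"
  by (simp add: super_dominating_set_def)

lemma pair_graph_lexicographic_product:
  assumes "pair_graph G" and "pair_graph H"
  shows "pair_graph (lexicographic_product G H)"
proof -
  interpret G: pair_graph G by fact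
  interpret H: pair_graph H by fact
  have "parcs (lexicographic_product G H)
      \<subseteq> (pverts G \<times> pverts H) \<times> (pverts G \<times> pverts H)"
    by (auto simp: lexicographic_product_def)
  moreover have "finite ((pverts G \<times> pverts H) \<times> (pverts G \<times> pverts H))"
    by simp
  ultimately have "finite (parcs (lexicographic_product G H))"
    by (rule finite_subset)
  moreover have "sym (parcs G)" "sym (parcs H)"
    using G.pair_sym_arcs H.pair_sym_arcs by (simp_all add: symmetric_def)
  then have "symmetric (with_proj (lexicographic_product G H))"
    by (auto simp: symmetric_def lexicographic_product_def intro!: symI dest: symD)
  ultimately show ?thesis
    using G.pair_no_loops H.pair_no_loops
    by unfold_locales (auto simp: lexicographic_product_def)
qed

end

theory Submission
  imports Defs
begin

text \<open>
  It is easier to count the vertices outside a super dominating set. Call \<open>C\<close> a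
  super dominating complement if each \<open>u \<in> C\<close> is the only neighbour in \<open>C\<close> of some vertex
  outside \<open>C\<close>; the super domination number is the order minus the largest size of such a set.
  The product \<open>K\<^sub>n \<circ> H\<close> consists of \<open>n\<close> copies of \<open>H\<close>, with every edge between different
  copies, so a vertex sees everything outside its own copy.

  Suppose that \<open>C\<close> meets several copies. The vertex \<open>v\<close> that singles out \<open>u\<close> cannot lie in the
  copy of \<open>u\<close>, since it would see the part of \<open>C\<close> in the other copies. Hence it lies in another
  copy, and it sees all of \<open>C\<close> except what lies in that copy: \<open>C\<close> meets only these two copies, and
  the copy of \<open>u\<close> in \<open>u\<close> alone. As this applies to every \<open>u \<in> C\<close>, the set \<open>C\<close> has exactly two
  elements (\<open>card_two_if_two_copies\<close>). If instead \<open>C\<close> lies in one copy and has at least two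
  elements, then a vertex in another copy sees too many of them, so \<open>C\<close> is a super dominating
  complement of \<open>H\<close> placed in that copy (\<open>super_dominating_complement_projection\<close>).

  Conversely, every super dominating complement of \<open>H\<close> can be placed in a copy. Moreover, two
  nonadjacent vertices \<open>x \<noteq> y\<close> of \<open>H\<close> always give a complement of size two: take \<open>x\<close> in two
  different copies, each singled out by \<open>y\<close> in the other copy. So the largest size for the product
  is the maximum of \<open>2\<close> and the largest size for \<open>H\<close>, which gives both assertions.
\<close>

definition super_dominating_complement :: "'a pair_pre_digraph \<Rightarrow> 'a set \<Rightarrow> bool" where
  "super_dominating_complement G C \<longleftrightarrow>
     C \<subseteq> pverts G \<and> (\<forall>u \<in> C. \<exists>v \<in> pverts G - C. neighbourhood G v \<inter> C = {u})"

lemma super_dominating_set_Diff_iff: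
  assumes "C \<subseteq> pverts G"
  shows "super_dominating_set G (pverts G - C) \<longleftrightarrow> super_dominating_complement G C"
  using assms
  by (simp add: super_dominating_set_def super_dominating_complement_def double_diff)

lemma finite_super_dominating_sets:
  assumes "finite (pverts G)"
  shows "finite {D. super_dominating_set G D}"
  by (rule finite_subset[of _ "Pow (pverts G)"]) (use assms in \<open>auto simp: super_dominating_set_def\<close>)

lemma super_domination_number_add_card_le:
  assumes fin: "finite (pverts G)" and C: "super_dominating_complement G C"
  shows "super_domination_number G + card C \<le> card (pverts G)"
proof -
  have sub: "C \<subseteq> pverts G"
    using C by (simp add: super_dominating_complement_def)
  then have "super_dominating_set G (pverts G - C)"
    using C super_dominating_set_Diff_iff by blast
  then have "super_domination_number G \<le> card (pverts G - C)"
    unfolding super_domination_number_def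
    by (intro Min_le) (use finite_super_dominating_sets[OF fin] in auto)
  moreover have "card (pverts G - C) + card C = card (pverts G)"
    using card_Diff_subset[OF finite_subset[OF sub fin] sub] card_mono[OF fin sub] by simp
  ultimately show ?thesis by linarith
qed

lemma super_domination_number_attained:
  assumes fin: "finite (pverts G)"
  obtains C where "super_dominating_complement G C"
    and "super_domination_number G + card C = card (pverts G)"
proof -
  have "super_domination_number G \<in> card ` {D. super_dominating_set G D}"
    unfolding super_domination_number_def
    by (intro Min_in) (use finite_super_dominating_sets[OF fin] super_dominating_set_pverts in auto)
  then obtain D where D: "super_dominating_set G D" "super_domination_number G = card D"
    by auto
  then have sub: "D \<subseteq> pverts G"
    by (simp add: super_dominating_set_def)
  have "super_dominating_complement G (pverts G - D)"
    using D(1) sub super_dominating_set_Diff_iff[of "pverts G - D" G] by (simp add: double_diff)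
  moreover have "super_domination_number G + card (pverts G - D) = card (pverts G)"
    using card_Diff_subset[OF finite_subset[OF sub fin] sub] card_mono[OF fin sub] D(2) by simp
  ultimately show thesis by (rule that)
qed

lemma neighbourhood_complete_lexicographic_product:
  assumes "complete_digraph n (with_proj K)" and "a \<in> pverts K" and "b \<in> pverts H"
  shows "neighbourhood (lexicographic_product K H) (a, b) =
    (pverts K - {a}) \<times> pverts H \<union> {a} \<times> neighbourhood H b"
proof -
  have "parcs K = {(u, v). u \<in> pverts K \<and> v \<in> pverts K \<and> u \<noteq> v}"
    using assms(1) by (auto simp: complete_digraph_def arcs_ends_def arc_to_ends_def)
  then show ?thesis
    using assms(2,3) by (auto simp: neighbourhood_def lexicographic_product_def)
qed

lemma pverts_lexicographic_product [simp]:
  "pverts (lexicographic_product G H) = pverts G \<times> pverts H"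
  by (simp add: lexicographic_product_def)

lemma super_dominating_complement_copy:
  assumes K: "complete_digraph n (with_proj K)" and g: "g \<in> pverts K"
    and C: "super_dominating_complement H C"
  shows "super_dominating_complement (lexicographic_product K H) ({g} \<times> C)"
  unfolding super_dominating_complement_def
proof (intro conjI ballI)
  show "{g} \<times> C \<subseteq> pverts (lexicographic_product K H)"
    using g C by (auto simp: super_dominating_complement_def)
next
  fix u assume "u \<in> {g} \<times> C"
  then obtain h where h: "u = (g, h)" "h \<in> C" by auto
  then obtain b where b: "b \<in> pverts H - C" "neighbourhood H b \<inter> C = {h}"
    using C by (auto simp: super_dominating_complement_def)
  have "neighbourhood (lexicographic_product K H) (g, b) \<inter> ({g} \<times> C) = {u}"
    using neighbourhood_complete_lexicographic_product[OF K g, of b H] b h by auto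
  then show "\<exists>v \<in> pverts (lexicographic_product K H) - {g} \<times> C.
      neighbourhood (lexicographic_product K H) v \<inter> ({g} \<times> C) = {u}"
    using g b(1) by (intro bexI[of _ "(g, b)"]) auto
qed

text \<open>
  The vertex \<open>(g', y)\<close> sees \<open>(g, x)\<close>, which lies in another copy, but misses \<open>(g', x)\<close> because \<open>x\<close>
  and \<open>y\<close> are not adjacent.
\<close>

lemma super_dominating_complement_two_copies:
  assumes K: "complete_digraph n (with_proj K)" and g: "g \<in> pverts K" "g' \<in> pverts K" "g \<noteq> g'"
    and xy: "x \<in> pverts H" "y \<in> pverts H" "x \<noteq> y" "x \<notin> neighbourhood H y"
  shows "super_dominating_complement (lexicographic_product K H) {(g, x), (g', x)}"
proof -
  let ?C = "{(g, x), (g', x)}"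
  have "neighbourhood (lexicographic_product K H) (g', y) \<inter> ?C = {(g, x)}"
    using neighbourhood_complete_lexicographic_product[OF K g(2) xy(2)] g xy by auto
  moreover have "neighbourhood (lexicographic_product K H) (g, y) \<inter> ?C = {(g', x)}"
    using neighbourhood_complete_lexicographic_product[OF K g(1) xy(2)] g xy by auto
  moreover have "(g, y) \<in> pverts (lexicographic_product K H) - ?C"
    and "(g', y) \<in> pverts (lexicographic_product K H) - ?C"
    using g xy by auto
  ultimately have "\<forall>u \<in> ?C. \<exists>v \<in> pverts (lexicographic_product K H) - ?C.
      neighbourhood (lexicographic_product K H) v \<inter> ?C = {u}"
    by blast
  then show ?thesis
    using g xy by (simp add: super_dominating_complement_def)
qed

text \<open>
  Let \<open>v\<close> single out \<open>u\<close>, and let \<open>a\<close> be the copy of \<open>v\<close>. As \<open>v\<close> sees every vertex outside \<open>a\<close>, no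
  element of \<open>C\<close> except \<open>u\<close> lies there. So \<open>w\<close> lies in \<open>a\<close>, and hence \<open>u\<close> does not.
\<close>

lemma outside_one_copy_singleton:
  assumes K: "complete_digraph n (with_proj K)"
    and C: "super_dominating_complement (lexicographic_product K H) C"
    and u: "u \<in> C" and w: "w \<in> C" "fst w \<noteq> fst u"
  shows "\<exists>a. a \<noteq> fst u \<and> {z \<in> C. fst z \<noteq> a} = {u}"
proof -
  have sub: "C \<subseteq> pverts K \<times> pverts H"
    using C by (simp add: super_dominating_complement_def)
  obtain v where v: "v \<in> pverts (lexicographic_product K H)"
      "neighbourhood (lexicographic_product K H) v \<inter> C = {u}"
    using C u unfolding super_dominating_complement_def by blast
  obtain a b where ab: "v = (a, b)" by (cases v)
  have N: "neighbourhood (lexicographic_product K H) v =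
      (pverts K - {a}) \<times> pverts H \<union> {a} \<times> neighbourhood H b"
    using neighbourhood_complete_lexicographic_product[OF K, of a b H] v(1) ab by simp
  have outside: "{z \<in> C. fst z \<noteq> a} \<subseteq> {u}"
  proof
    fix z assume "z \<in> {z \<in> C. fst z \<noteq> a}"
    then have "z \<in> C" "fst z \<noteq> a" by simp_all
    with sub have "z \<in> neighbourhood (lexicographic_product K H) v"
      unfolding N by (cases z) auto
    with \<open>z \<in> C\<close> show "z \<in> {u}"
      unfolding v(2)[symmetric] by simp
  qed
  have "a \<noteq> fst u"
    using outside w by blast
  with outside u show ?thesis by blast
qed

text \<open>
  The preceding lemma applies to \<open>u\<close> and to \<open>w\<close>: all of \<open>C\<close> but \<open>u\<close> lies in the copy of \<open>w\<close>, and
  all of \<open>C\<close> but \<open>w\<close> lies outside it.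
\<close>

lemma card_two_if_two_copies:
  assumes K: "complete_digraph n (with_proj K)"
    and C: "super_dominating_complement (lexicographic_product K H) C"
    and u: "u \<in> C" and w: "w \<in> C" and "fst w \<noteq> fst u"
  shows "card C = 2"
proof -
  obtain a where a: "a \<noteq> fst u" "{z \<in> C. fst z \<noteq> a} = {u}"
    using outside_one_copy_singleton[OF K C u w] assms(5) by blast
  obtain a' where a': "a' \<noteq> fst w" "{z \<in> C. fst z \<noteq> a'} = {w}"
    using outside_one_copy_singleton[OF K C w u] assms(5) by metis
  have aw: "a = fst w"
  proof (rule ccontr)
    assume "a \<noteq> fst w"
    with w a(2) have "w = u" by blast
    with assms(5) show False by simp
  qed
  have "z = u \<or> z = w" if "z \<in> C" for z
  proof (cases "fst z = a")
    case True
    with a'(1) have "fst z \<noteq> a'" using aw by simp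
    with a'(2) that show ?thesis by blast
  next
    case False
    with a(2) that show ?thesis by blast
  qed
  with u w have "C = {u, w}" by blast
  moreover have "u \<noteq> w"
    using assms(5) by auto
  ultimately show ?thesis
    by simp
qed

text \<open>
  The bound on the size matters: a single vertex \<open>(g, h)\<close> is singled out by any vertex of another
  copy, even if \<open>h\<close> is isolated in \<open>H\<close>, in which case \<open>{h}\<close> is not a super dominating complement of \<open>H\<close>.
\<close>

lemma super_dominating_complement_projection:
  assumes K: "complete_digraph n (with_proj K)"
    and C: "super_dominating_complement (lexicographic_product K H) ({g} \<times> C')"
    and card: "card C' \<ge> 2"
  shows "super_dominating_complement H C'"
proof -
  have ne: "C' \<noteq> {}" using card by auto
  then have sub: "g \<in> pverts K" "C' \<subseteq> pverts H"
    using C by (auto simp: super_dominating_complement_def)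
  have "\<exists>b \<in> pverts H - C'. neighbourhood H b \<inter> C' = {h}" if h: "h \<in> C'" for h
  proof -
    have "(g, h) \<in> {g} \<times> C'" using h by simp
    then obtain v where v': "v \<in> pverts (lexicographic_product K H) - {g} \<times> C'"
        "neighbourhood (lexicographic_product K H) v \<inter> ({g} \<times> C') = {(g, h)}"
      using C unfolding super_dominating_complement_def by blast
    obtain a b where ab: "v = (a, b)" by (cases v)
    have v: "a \<in> pverts K" "b \<in> pverts H" "(a, b) \<notin> {g} \<times> C'"
      using v'(1) ab by simp_all
    have seen: "(k \<in> C' \<and> (g \<noteq> a \<or> k \<in> neighbourhood H b)) \<longleftrightarrow> k = h" for k
    proof -
      have "(g, k) \<in> neighbourhood (lexicographic_product K H) (a, b) \<inter> ({g} \<times> C') \<longleftrightarrow> k = h"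
        unfolding v'(2)[unfolded ab] by simp
      then show ?thesis
        unfolding neighbourhood_complete_lexicographic_product[OF K v(1,2)] using sub by blast
    qed
    have "a = g"
    proof (rule ccontr)
      \<comment> \<open>A vertex in another copy would see all of \<open>{g} \<times> C'\<close>.\<close>
      assume "a \<noteq> g"
      then have "C' \<subseteq> {h}"
        using seen by blast
      then show False
        using card_mono[of "{h}" C'] card by simp
    qed
    then have "neighbourhood H b \<inter> C' = {h}" and "b \<in> pverts H - C'"
      using seen v by blast+
    then show ?thesis by blast
  qed
  then show ?thesis
    using sub by (auto simp: super_dominating_complement_def)
qed

text \<open>
  The two assertions are the cases in which the maximum is attained by \<open>2\<close> and by the largest size
  \<open>card (pverts H) - super_domination_number H\<close> of a complement in \<open>H\<close>.
\<close>

lemma super_domination_number_complete_lexicographic_product: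
  assumes H: "finite (pverts H)" "x \<in> pverts H" "y \<in> pverts H" "x \<noteq> y" "x \<notin> neighbourhood H y"
    and K: "complete_digraph n (with_proj K)" and n: "n \<ge> 2"
  shows "super_domination_number (lexicographic_product K H)
    + max 2 (card (pverts H) - super_domination_number H) = n * card (pverts H)"
    (is "?\<gamma> + max 2 ?m = _")
proof -
  let ?P = "lexicographic_product K H"
  have cardK: "card (pverts K) = n"
    using K by (simp add: complete_digraph_def)
  then have finK: "finite (pverts K)"
    using n by (intro card_ge_0_finite) simp
  then have finP: "finite (pverts ?P)"
    using H(1) by simp
  have cardP: "card (pverts ?P) = n * card (pverts H)"
    by (simp add: cardK card_cartesian_product)
  obtain S where "S \<subseteq> pverts K" "card S = 2"
    using n cardK obtain_subset_with_card_n[of 2 "pverts K"] by auto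
  then obtain g g' where g: "g \<in> pverts K" "g' \<in> pverts K" "g \<noteq> g'"
    by (auto simp: card_2_iff)
  have "?\<gamma> + 2 \<le> n * card (pverts H)"
    using super_domination_number_add_card_le[OF finP
        super_dominating_complement_two_copies[OF K g H(2-5)]] g cardP by simp
  moreover have "?\<gamma> + ?m \<le> n * card (pverts H)"
  proof -
    obtain C where C: "super_dominating_complement H C"
        "super_domination_number H + card C = card (pverts H)"
      using super_domination_number_attained[OF H(1)] by blast
    have "?\<gamma> + card ({g} \<times> C) \<le> n * card (pverts H)"
      using super_domination_number_add_card_le[OF finP
          super_dominating_complement_copy[OF K g(1) C(1)]] cardP by simp
    moreover have "card ({g} \<times> C) = ?m"
      using C(2) by (simp add: card_cartesian_product)
    ultimately show ?thesis by simp
  qed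
  moreover have "n * card (pverts H) \<le> ?\<gamma> + max 2 ?m"
  proof -
    obtain C where C: "super_dominating_complement ?P C" "?\<gamma> + card C = card (pverts ?P)"
      using super_domination_number_attained[OF finP] by blast
    have "card C \<le> max 2 ?m"
    proof (cases "\<exists>u \<in> C. \<exists>w \<in> C. fst w \<noteq> fst u")
      case True
      then show ?thesis
        using card_two_if_two_copies[OF K C(1)] by auto
    next
      case False
      show ?thesis
      proof (cases "card C \<ge> 2")
        case True
        then have "C \<noteq> {}" by auto
        then obtain u where "u \<in> C" by blast
        with False have same: "fst z = fst u" if "z \<in> C" for z
          using that by blast
        have copy: "C = {fst u} \<times> snd ` C"
        proof (intro subset_antisym subsetI)
          fix z assume "z \<in> C"
          then show "z \<in> {fst u} \<times> snd ` C"
            using same by (simp add: mem_Times_iff)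
        next
          fix z assume "z \<in> {fst u} \<times> snd ` C"
          then obtain w where "w \<in> C" "z = (fst u, snd w)" by auto
          then show "z \<in> C"
            using same[of w] by (metis prod.collapse)
        qed
        have card: "card (snd ` C) = card C"
          using card_cartesian_product_singleton[of "fst u" "snd ` C"] unfolding copy[symmetric] ..
        have "super_dominating_complement H (snd ` C)"
        proof (rule super_dominating_complement_projection[OF K])
          show "super_dominating_complement ?P ({fst u} \<times> snd ` C)"
            using C(1) unfolding copy[symmetric] .
        qed (use True card in simp)
        then show ?thesis
          using super_domination_number_add_card_le[OF H(1), of "snd ` C"] card by simp
      qed simp
    qed
    then show ?thesis using C(2) cardP by linarith
  qed
  ultimately show ?thesis by linarith
qed

lemma not_complete_obtain_nonadjacent:
  assumes "pair_graph H" and "\<not> complete_digraph (card (pverts H)) (with_proj H)"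
  obtains x y where "x \<in> pverts H" "y \<in> pverts H" "x \<noteq> y" "x \<notin> neighbourhood H y"
proof -
  interpret pair_graph H by fact
  have "graph (with_proj H)" by unfold_locales
  then have "parcs H \<noteq> {(u, v). u \<in> pverts H \<and> v \<in> pverts H \<and> u \<noteq> v}"
    using assms(2) by (auto simp: complete_digraph_def arcs_ends_def arc_to_ends_def)
  moreover have "parcs H \<subseteq> {(u, v). u \<in> pverts H \<and> v \<in> pverts H \<and> u \<noteq> v}"
    using in_arcsD1 in_arcsD2 pair_no_loops by fastforce
  ultimately obtain u v where "u \<in> pverts H" "v \<in> pverts H" "u \<noteq> v" "(u, v) \<notin> parcs H"
    by auto
  then show thesis
    using that[of v u] by (auto simp: neighbourhood_def)
qed

theorem proposition16:
  fixes K :: "'a pair_pre_digraph" and H :: "'b pair_pre_digraph" and n n' :: nat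
  assumes "pair_graph H" and "pverts H \<noteq> {}" and "card (pverts H) = n'"
    and "\<not> complete_digraph n' (with_proj H)"
    and "n \<ge> 2" and "complete_digraph n (with_proj K)"
  shows "(super_domination_number H = n' - 1 \<longrightarrow>
           super_domination_number (lexicographic_product K H) = n * n' - 2) \<and>
         (super_domination_number H \<le> n' - 2 \<longrightarrow>
           super_domination_number (lexicographic_product K H)
             = n' * (n - 1) + super_domination_number H)"
proof -
  interpret H: pair_graph H by fact
  have fin: "finite (pverts H)" by simp
  obtain x y where xy: "x \<in> pverts H" "y \<in> pverts H" "x \<noteq> y" "x \<notin> neighbourhood H y"
    using not_complete_obtain_nonadjacent[OF assms(1)] assms(3,4) by blast
  have "card {x, y} \<le> n'"
    unfolding assms(3)[symmetric] by (rule card_mono) (use fin xy in auto)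
  then have n': "n' \<ge> 2" using xy(3) by simp
  have main: "super_domination_number (lexicographic_product K H)
      + max 2 (n' - super_domination_number H) = n * n'"
    using super_domination_number_complete_lexicographic_product[OF fin xy assms(6,5)] assms(3)
    by simp
  have "n * n' = n' * (n - 1) + n'"
    using assms(5) by (cases n) auto
  then show ?thesis
    using main n' by linarith
qed

end
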